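(* Let $\mu\in\mathbb{R}$ with $\mu+\tfrac12\notin\{0,-1,-2,\dots\}$, and let $V_\mu$ be the Dunkl intertwining operator. Then for every integer $n\ge 0$ and every $\epsilon\in\{0,1\}$, $$V_{\mu} H_{2n+\epsilon}(x)= \frac{(\frac{1}{2})_{n+\epsilon}}{(\mu +\frac{1}{2})_{n+\epsilon}}\,\sum_{\ell = 0}^n (-1)^{\ell}\, 2^{2\ell}\, \binom{n}{\ell}\,(\mu)_{\ell}\, H_{2(n-\ell)+\epsilon}(x).$$
   Context: For $a\in\mathbb{R}$ and an integer $m\ge 0$, $(a)_m=a(a+1)\cdots(a+m-1)$ is the Pochhammer symbol, with $(a)_0=1$. The Dunkl intertwining operator $V_\mu$ (for the group $\mathbb{Z}_2$) is the linear operator on polynomials in one variable $x$ determined by its action on monomials: $V_{\mu}(x^{2n+\epsilon})=\frac{(\frac12)_{n+\epsilon}}{(\mu+\frac12)_{n+\epsilon}}\,x^{2n+\epsilon}$ for $n=0,1,2,\dots$ and $\epsilon\in\{0,1\}$. $H_m(x)$ denotes the (physicists') Hermite polynomials, given for $n\ge 0$ and $\epsilon\in\{0,1\}$ by $$H_{2n+\epsilon}(x)=\sum_{k=0}^n \frac{(-1)^{n-k}\,2^{2k+\epsilon}\,(2n+\epsilon)!}{(2k+\epsilon)!\,(n-k)!}\,x^{2k+\epsilon}.$$ *)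

theory Defs
  imports Complex_Main "HOL-Computational_Algebra.Polynomial" "HOL-Library.Nonpos_Ints"
begin

(* The exponent 2n + \<epsilon> is encoded by its value m: n = m div 2 and \<epsilon> = m mod 2,
   so that n + \<epsilon> = m div 2 + m mod 2. *)
definition dunkl_coeff :: "real \<Rightarrow> nat \<Rightarrow> real" where
  "dunkl_coeff \<mu> m =
     pochhammer (1/2) (m div 2 + m mod 2) / pochhammer (\<mu> + 1/2) (m div 2 + m mod 2)"

(* The linear extension of x^m \<mapsto> dunkl_coeff \<mu> m * x^m; the facts dunkl_V_linear, dunkl_V_monom
   and dunkl_V_unique below show that it is the only linear operator with this action. *)
definition dunkl_V :: "real \<Rightarrow> real poly \<Rightarrow> real poly" where
  "dunkl_V \<mu> p = (\<Sum>m\<le>degree p. monom (coeff p m * dunkl_coeff \<mu> m) m)"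

(* Physicists' normalization. *)
definition hermite :: "nat \<Rightarrow> real poly" where
  "hermite m =
     (\<Sum>k=0..m div 2.
        monom ((-1) ^ (m div 2 - k) * 2 ^ (2 * k + m mod 2) * fact m
               / (fact (2 * k + m mod 2) * fact (m div 2 - k)))
              (2 * k + m mod 2))"

lemma coeff_dunkl_V: "coeff (dunkl_V \<mu> p) m = dunkl_coeff \<mu> m * coeff p m"
proof (cases "m \<le> degree p")
  case True
  then show ?thesis
    by (simp add: dunkl_V_def coeff_sum sum.delta)
next
  case False
  then show ?thesis
    by (simp add: dunkl_V_def coeff_sum sum.delta coeff_eq_0)
qed

lemma dunkl_V_linear: "Vector_Spaces.linear smult smult (dunkl_V \<mu>)"
proof -
  have vs: "vector_space (smult :: real \<Rightarrow> real poly \<Rightarrow> real poly)"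
    by unfold_locales (simp_all add: smult_add_right smult_add_left)
  show ?thesis
    unfolding Vector_Spaces.linear_def module_hom_def module_hom_axioms_def
    using vs by (simp add: vector_space_def module_def poly_eq_iff coeff_dunkl_V algebra_simps)
qed

lemma dunkl_V_monom:
  assumes "\<epsilon> \<in> {0, 1}"
  shows "dunkl_V \<mu> (monom 1 (2 * n + \<epsilon>)) =
           smult (pochhammer (1/2) (n + \<epsilon>) / pochhammer (\<mu> + 1/2) (n + \<epsilon>)) (monom 1 (2 * n + \<epsilon>))"
  using assms by (auto simp: poly_eq_iff coeff_dunkl_V dunkl_coeff_def)

lemma dunkl_V_unique:
  assumes lin: "Vector_Spaces.linear smult smult V"
    and mon: "\<And>n \<epsilon>. \<epsilon> \<in> {0, 1} \<Longrightarrow> V (monom 1 (2 * n + \<epsilon>)) =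
           smult (pochhammer (1/2) (n + \<epsilon>) / pochhammer (\<mu> + 1/2) (n + \<epsilon>)) (monom 1 (2 * n + \<epsilon>))"
  shows "V = dunkl_V \<mu>"
proof
  fix p :: "real poly"
  interpret V: Vector_Spaces.linear smult smult V by (rule lin)
  interpret D: Vector_Spaces.linear smult smult "dunkl_V \<mu>" by (rule dunkl_V_linear)
  have eq: "V (monom 1 m) = dunkl_V \<mu> (monom 1 m)" for m
  proof -
    have "m mod 2 \<in> {0, 1}" by auto
    from mon[OF this, of "m div 2"] dunkl_V_monom[OF this, of \<mu> "m div 2"] show ?thesis
      by simp
  qed
  have p: "p = (\<Sum>m\<le>degree p. smult (coeff p m) (monom 1 m))"
    by (simp add: smult_monom poly_as_sum_of_monoms)
  show "V p = dunkl_V \<mu> p"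
    by (subst (1 2) p) (simp only: V.sum D.sum V.scale D.scale eq)
qed

lemma hermite_explicit:
  assumes "\<epsilon> \<in> {0, 1}"
  shows "hermite (2 * n + \<epsilon>) =
     (\<Sum>k=0..n. monom ((-1) ^ (n - k) * 2 ^ (2 * k + \<epsilon>) * fact (2 * n + \<epsilon>)
                    / (fact (2 * k + \<epsilon>) * fact (n - k))) (2 * k + \<epsilon>))"
  using assms by (auto simp: hermite_def)

end

theory Submission imports Defs begin

text \<open>
  Both sides are compared coefficientwise. By the duplication formula,
  $(2j+\epsilon)! = 2^{2j+\epsilon}\, j!\, (1/2)_{j+\epsilon}$, so the coefficient of
  $x^{2k+\epsilon}$ in the sum on the right becomes a multiple of
  $\sum_l {n-k \choose l} (\mu)_l (k+\epsilon+1/2)_{n-k-l}$, which the Chu--Vandermonde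
  identity evaluates to
  $(\mu+k+\epsilon+1/2)_{n-k} = (\mu+1/2)_{n+\epsilon} / (\mu+1/2)_{k+\epsilon}$.
\<close>

text \<open>For \<epsilon> = 1 the extra factor 2n + 1 = 2 (n + 1/2) of the factorial supplies one
  more power of 2 and the last factor of the Pochhammer symbol.\<close>

lemma fact_duplication:
  assumes "\<epsilon> \<in> {0, 1}"
  shows "(fact (2 * n + \<epsilon>) :: real) = 2 ^ \<epsilon> * 2 ^ (2 * n) * fact n * pochhammer (1/2) (n + \<epsilon>)"
  using assms by (auto simp: fact_double pochhammer_Suc)

lemma coeff_hermite:
  assumes "\<epsilon> \<in> {0, 1}"
  shows "coeff (hermite (2 * n + \<epsilon>)) (2 * k + \<epsilon>) =
           (if k \<le> n then (-1) ^ (n - k) * 2 ^ (2 * k + \<epsilon>) * fact (2 * n + \<epsilon>)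
                            / (fact (2 * k + \<epsilon>) * fact (n - k)) else 0)"
  unfolding hermite_explicit[OF assms] by (simp add: coeff_sum sum.delta)

lemma coeff_hermite_parity:
  assumes "\<epsilon> \<in> {0, 1}" and "odd (m + \<epsilon>)"
  shows "coeff (hermite (2 * n + \<epsilon>)) m = 0"
  unfolding hermite_explicit[OF assms(1)] using assms(2)
  by (auto simp: coeff_sum intro!: sum.neutral split: if_splits)

lemma pochhammer_nonzero:
  assumes "(x::real) \<notin> \<int>\<^sub>\<le>\<^sub>0"
  shows "pochhammer x n \<noteq> 0"
  using assms by (auto simp: pochhammer_eq_0_iff)

text \<open>After the duplication formula is applied to (2(n-l)+\<epsilon>)!, all dependence on l
  can be gathered into a Chu-Vandermonde summand of order n-k; the remaining factors leave the
  sum.\<close>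

lemma sum_pochhammer_coeff_hermite:
  fixes \<mu> :: real
  assumes \<epsilon>: "\<epsilon> \<in> {0, 1}" and k: "k \<le> n"
  shows "(\<Sum>l=0..n. (-1) ^ l * 2 ^ (2 * l) * of_nat (n choose l) * pochhammer \<mu> l
            * coeff (hermite (2 * (n - l) + \<epsilon>)) (2 * k + \<epsilon>)) =
         (-1) ^ (n - k) * 2 ^ (2 * k + \<epsilon>) * 2 ^ \<epsilon> * 2 ^ (2 * n) * fact n
           / (fact (2 * k + \<epsilon>) * fact (n - k))
           * pochhammer (1/2) (k + \<epsilon>) * pochhammer (\<mu> + 1/2 + of_nat (k + \<epsilon>)) (n - k)"
    (is "sum ?f _ = ?C * pochhammer _ _ * _")
proof -
  \<comment> \<open>For l > n-k the degree 2(n-l)+\<epsilon> of the Hermite polynomial is below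
    2k+\<epsilon>.\<close>
  have "sum ?f {0..n} = sum ?f {..n - k}"
    using k by (intro sum.mono_neutral_right) (auto simp: coeff_hermite[OF \<epsilon>])
  also have "\<dots> = (\<Sum>l\<le>n - k. ?C * pochhammer (1/2) (k + \<epsilon>) *
      (of_nat ((n - k) choose l) * pochhammer \<mu> l * pochhammer (1/2 + of_nat (k + \<epsilon>)) (n - k - l)))"
  proof (rule sum.cong)
    fix l assume "l \<in> {..n - k}"
    then have l: "l \<le> n - k" "l \<le> n" "k \<le> n - l" using k by auto
    have "n - k = l + (n - l - k)" "2 * n = 2 * l + 2 * (n - l)"
      using l by auto
    then have sgn: "(-1::real) ^ (n - k) = (-1) ^ l * (-1) ^ (n - l - k)"
      and pow: "(2::real) ^ (2 * n) = 2 ^ (2 * l) * 2 ^ (2 * (n - l))"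
      by (metis power_add)+
    \<comment> \<open>Both sides equal n! / (l! (n-k-l)!). This trades the binomial of n for the
      binomial of n-k.\<close>
    have fact: "of_nat (n choose l) * fact (n - l) / fact (n - l - k) =
        (fact n * of_nat ((n - k) choose l) / fact (n - k) :: real)"
      unfolding binomial_fact[OF l(1)] binomial_fact[OF l(2)]
      by (simp add: add.commute)
    \<comment> \<open>Splitting after k+\<epsilon> factors leaves a symbol of length n-k-l, the
      partner of (\<mu>)_l in the convolution.\<close>
    have poch: "pochhammer (1/2 :: real) (n - l + \<epsilon>) =
        pochhammer (1/2) (k + \<epsilon>) * pochhammer (1/2 + of_nat (k + \<epsilon>)) (n - k - l)"
      using l pochhammer_product[of "k + \<epsilon>" "n - l + \<epsilon>" "1/2::real"] by (simp add: add.commute)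
    have "?f l = (-1) ^ l * 2 ^ (2 * l) * of_nat (n choose l) * pochhammer \<mu> l *
       ((-1) ^ (n - l - k) * 2 ^ (2 * k + \<epsilon>)
         * (2 ^ \<epsilon> * 2 ^ (2 * (n - l)) * fact (n - l) * pochhammer (1/2) (n - l + \<epsilon>))
                            / (fact (2 * k + \<epsilon>) * fact (n - l - k)))"
      using l by (simp add: coeff_hermite[OF \<epsilon>] fact_duplication[OF \<epsilon>, of "n - l"])
    also have "\<dots> = (-1) ^ l * (-1) ^ (n - l - k) * (2 ^ (2 * l) * 2 ^ (2 * (n - l)))
        * 2 ^ (2 * k + \<epsilon>) * 2 ^ \<epsilon> * pochhammer \<mu> l * pochhammer (1/2) (n - l + \<epsilon>) / fact (2 * k + \<epsilon>)
        * (of_nat (n choose l) * fact (n - l) / fact (n - l - k))"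
      by (simp only: divide_inverse inverse_mult_distrib mult_ac)
    also have "\<dots> = ?C * pochhammer (1/2) (k + \<epsilon>) *
      (of_nat ((n - k) choose l) * pochhammer \<mu> l * pochhammer (1/2 + of_nat (k + \<epsilon>)) (n - k - l))"
      unfolding fact poch sgn[symmetric] pow[symmetric]
      by (simp only: divide_inverse inverse_mult_distrib mult_ac)
    finally show "?f l = \<dots>" .
  qed simp
  \<comment> \<open>Chu-Vandermonde with parameters \<mu> and 1/2+k+\<epsilon>.\<close>
  also have "\<dots> = ?C * pochhammer (1/2) (k + \<epsilon>) * pochhammer (\<mu> + (1/2 + of_nat (k + \<epsilon>))) (n - k)"
    by (simp only: pochhammer_binomial_sum sum_distrib_left)
  finally show ?thesis by (simp only: add.assoc)
qed

theorem theorem3p1: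
  fixes \<mu> :: real and n \<epsilon> :: nat
  assumes "\<mu> + 1/2 \<notin> \<int>\<^sub>\<le>\<^sub>0"
    and "\<epsilon> \<in> {0, 1}"
  shows "dunkl_V \<mu> (hermite (2 * n + \<epsilon>)) =
           smult (pochhammer (1/2) (n + \<epsilon>) / pochhammer (\<mu> + 1/2) (n + \<epsilon>))
             (\<Sum>l=0..n. smult ((-1) ^ l * 2 ^ (2 * l) * of_nat (n choose l) * pochhammer \<mu> l)
                               (hermite (2 * (n - l) + \<epsilon>)))"
    (is "?L = ?R")
proof (rule poly_eqI)
  fix m
  show "coeff ?L m = coeff ?R m"
  proof (cases "odd (m + \<epsilon>)")
    case True
    \<comment> \<open>Both sides vanish: every Hermite index has the parity of \<epsilon>, and
      \<open>dunkl_V\<close> only rescales coefficients.\<close>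
    then show ?thesis
      by (simp add: coeff_dunkl_V coeff_sum coeff_hermite_parity[OF assms(2)])
  next
    case False
    define k where "k = m div 2"
    have m: "m = 2 * k + \<epsilon>"
      using False assms(2) by (auto simp: k_def)
    show ?thesis
    proof (cases "k \<le> n")
      case False
      then have "\<not> k \<le> n - l" for l
        by simp
      with False show ?thesis
        by (simp add: m coeff_dunkl_V coeff_sum coeff_hermite[OF assms(2)])
    next
      case True
      let ?P = "pochhammer (\<mu> + 1/2)"
        and ?Q = "pochhammer (\<mu> + 1/2 + of_nat (k + \<epsilon>)) (n - k)"
        and ?C = "(-1) ^ (n - k) * 2 ^ (2 * k + \<epsilon>) * 2 ^ \<epsilon> * 2 ^ (2 * n) * fact n
                    / (fact (2 * k + \<epsilon>) * fact (n - k)) :: real"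
      have P: "?P (n + \<epsilon>) = ?P (k + \<epsilon>) * ?Q"
        using True pochhammer_product[of "k + \<epsilon>" "n + \<epsilon>" "\<mu> + 1/2"] by simp
      \<comment> \<open>\<open>?Q\<close> divides \<open>?P (n + \<epsilon>)\<close>, which is
        nonzero by the assumption on \<mu>.\<close>
      then have Q: "?Q \<noteq> 0"
        using pochhammer_nonzero[OF assms(1), of "n + \<epsilon>"] by (metis mult_zero_right)
      have "coeff ?L m = pochhammer (1/2) (k + \<epsilon>) / ?P (k + \<epsilon>) * (?C * pochhammer (1/2) (n + \<epsilon>))"
      proof -
        have "dunkl_coeff \<mu> m = pochhammer (1/2) (k + \<epsilon>) / ?P (k + \<epsilon>)"
          using assms(2) by (auto simp: m dunkl_coeff_def)
        moreover have "coeff (hermite (2 * n + \<epsilon>)) m = ?C * pochhammer (1/2) (n + \<epsilon>)"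
          unfolding m coeff_hermite[OF assms(2)] fact_duplication[OF assms(2), of n] using True by simp
        ultimately show ?thesis by (simp only: coeff_dunkl_V)
      qed
      \<comment> \<open>The symbol (1/2)_{k+\<epsilon>} from the operator and (1/2)_{n+\<epsilon>}
        from the Hermite factorial swap roles; the latter becomes the numerator of the
        prefactor.\<close>
      also have "\<dots> = pochhammer (1/2) (n + \<epsilon>) / ?P (k + \<epsilon>) * (?C * pochhammer (1/2) (k + \<epsilon>))"
        by (simp only: divide_inverse mult_ac)
      \<comment> \<open>Expanding the fraction by \<open>?Q\<close> completes the denominator of the
        prefactor and produces the value of the Chu-Vandermonde sum.\<close>
      also have "\<dots> = pochhammer (1/2) (n + \<epsilon>) / ?P (n + \<epsilon>)
                        * (?C * pochhammer (1/2) (k + \<epsilon>) * ?Q)"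
      proof -
        have "a / p * c = a / (p * q) * (c * q)" if "q \<noteq> 0" for a p q c :: real
          using that by simp
        from this[OF Q] show ?thesis unfolding P .
      qed
      also have "\<dots> = coeff ?R m"
        unfolding m coeff_smult coeff_sum sum_pochhammer_coeff_hermite[OF assms(2) True] ..
      finally show ?thesis .
    qed
  qed
qed

end
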